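(* Let $\mu,\gamma>0$, let $f\in\mathcal{S}_{\mu}(\mathbb{R}^{d_1})$ and let $g$ be a function on $\mathbb{R}^{d_2}$ whose conjugate satisfies $g^{\star}\in\mathcal{S}_{\gamma}(\mathbb{R}^{d_2})$. Let $F\in\mathbb{R}^{d_2\times d_1}$ and $s>0$ with $s^2\in(0,\|F\|^{-2})$. Let $(x^{\star},y^{\star})$ be a saddle point of $\Phi(x,y)=f(x)+\langle Fx,y\rangle-g^{\star}(y)$. Let $\{(x_k,y_k)\}_{k\ge0}$ be generated from arbitrary $(x_0,y_0)\in\mathbb{R}^{d_1}\times\mathbb{R}^{d_2}$ by the PDHG algorithm with $\theta_k=1$ and constant step sizes $\tau_k=\tau$, $\sigma_k=\sigma$, where $$\tau=s\sqrt{\frac{\gamma}{\mu}},\qquad\sigma=s\sqrt{\frac{\mu}{\gamma}}.$$ For $k\ge0$ define $$\mathcal{E}(k)=\frac{1}{2\tau}\|x_k-x^{\star}\|^2+\frac{1}{2\sigma}\|y_k-y^{\star}\|^2-\langle F(x_k-x^{\star}),y_k-y^{\star}\rangle.$$ Then for every $k\ge0$, $$\mathcal{E}(k)\le\left(\frac{1+s\|F\|}{1+s\|F\|+2s\sqrt{\mu\gamma}}\right)^{k}\mathcal{E}(0).$$ Furthermore, the sequence $\{(x_k,y_k)\}_{k\ge0}$ converges to $(x^{\star},y^{\star})$ at the rate $$\mu\|x_k-x^{\star}\|^2+\gamma\|y_k-y^{\star}\|^2\le\frac{1+s\|F\|}{1-s\|F\|}\left(\frac{1+s\|F\|}{1+s\|F\|+2s\sqrt{\mu\gamma}}\right)^{k}\left(\mu\|x_0-x^{\star}\|^2+\gamma\|y_0-y^{\star}\|^2\right)$$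 for every $k\ge 0$.
   Context: Notation. $\|\cdot\|$ is the Euclidean norm on vectors and the induced operator (spectral) norm on matrices. $\mathcal{F}(\mathbb{R}^d)$ is the class of proper, lower semi-continuous, convex functions $\mathbb{R}^d\to(-\infty,\infty]$. A vector $v$ is a subgradient of a convex $f$ at $x\in\mathrm{dom}(f)$ if $f(y)\ge f(x)+\langle v,y-x\rangle$ for all $y$; $\partial f(x)$ is the set of subgradients. $\mathcal{S}_{\mu}(\mathbb{R}^d)\subset\mathcal{F}(\mathbb{R}^d)$ is the class of $\mu$-strongly convex functions: $f(y)\ge f(x)+\langle v,y-x\rangle+\frac{\mu}{2}\|y-x\|^2$ for all $x,y$ and all $v\in\partial f(x)$. The conjugate of $g$ is $g^{\star}(y)=\sup_{x}(\langle y,x\rangle-g(x))$. A saddle point of $\Phi$ is a pair $(x^{\star},y^{\star})$ with $\Phi(x^{\star},y)\le\Phi(x^{\star},y^{\star})\le\Phi(x,y^{\star})$ for all $x\in\mathbb{R}^{d_1}$, $y\in\mathbb{R}^{d_2}$; for $\Phi(x,y)=f(x)+\langle Fx,y\rangle-g^{\star}(y)$ this is equivalent to $-F^{\top}y^{\star}\in\partial f(x^{\star})$ and $Fx^{\star}\in\partial g^{\star}(y^{\star})$. PDHG algorithm with parameters $\tau_k,\sigma_k>0$ and $\theta_k\in(0,1]$: for $k=0,1,2,\dots$, $$x_{k+1}=\operatorname{argmin}_{x\in\mathbb{R}^{d_1}}\Big\{f(x)+\langle Fx,y_k\rangle+\tfrac{1}{2\tau_k}\|x-x_k\|^2\Big\},$$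 $$\overline{x}_{k+1}=x_{k+1}+\theta_k(x_{k+1}-x_k),$$ $$y_{k+1}=\operatorname{argmax}_{y\in\mathbb{R}^{d_2}}\Big\{-g^{\star}(y)+\langle F\overline{x}_{k+1},y\rangle-\tfrac{1}{2\sigma_k}\|y-y_k\|^2\Big\}.$$ *)

theory Defs
  imports "HOL-Analysis.Analysis"
begin

definition edom :: "('a \<Rightarrow> ereal) \<Rightarrow> 'a set" where
  "edom f = {x. f x < \<infinity>}"

definition proper_fun :: "('a \<Rightarrow> ereal) \<Rightarrow> bool" where
  "proper_fun f \<longleftrightarrow> (\<forall>x. f x \<noteq> -\<infinity>) \<and> edom f \<noteq> {}"

definition lsc_fun :: "('a::topological_space \<Rightarrow> ereal) \<Rightarrow> bool" where
  "lsc_fun f \<longleftrightarrow> (\<forall>x. f x \<le> Liminf (at x) f)"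

(* For functions that avoid -\<infinity> the right-hand side contains no indeterminate sum,
   and 0 * \<infinity> = 0 makes the endpoints t = 0, 1 trivial. *)
definition convex_efun :: "('a::real_vector \<Rightarrow> ereal) \<Rightarrow> bool" where
  "convex_efun f \<longleftrightarrow>
     (\<forall>x y. \<forall>t\<in>{0..1}. f ((1 - t) *\<^sub>R x + t *\<^sub>R y) \<le> ereal (1 - t) * f x + ereal t * f y)"

definition closed_convex_funs :: "('a::euclidean_space \<Rightarrow> ereal) set" where
  "closed_convex_funs = {f. proper_fun f \<and> lsc_fun f \<and> convex_efun f}"

definition subdifferential :: "('a::real_inner \<Rightarrow> ereal) \<Rightarrow> 'a \<Rightarrow> 'a set" where
  "subdifferential f x = {v. x \<in> edom f \<and> (\<forall>y. f y \<ge> f x + ereal (v \<bullet> (y - x)))}"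

definition strongly_convex_funs :: "real \<Rightarrow> ('a::euclidean_space \<Rightarrow> ereal) set" where
  "strongly_convex_funs \<mu> = {f \<in> closed_convex_funs.
     \<forall>x y. \<forall>v\<in>subdifferential f x.
       f y \<ge> f x + ereal (v \<bullet> (y - x)) + ereal (\<mu> / 2 * (norm (y - x))\<^sup>2)}"

definition conjugate_fun :: "('a::real_inner \<Rightarrow> ereal) \<Rightarrow> 'a \<Rightarrow> ereal" where
  "conjugate_fun g y = (SUP x. ereal (y \<bullet> x) - g x)"

definition saddle_point :: "('a \<Rightarrow> 'b \<Rightarrow> ereal) \<Rightarrow> 'a \<Rightarrow> 'b \<Rightarrow> bool" where
  "saddle_point \<Phi> xs ys \<longleftrightarrow> (\<forall>x y. \<Phi> xs y \<le> \<Phi> xs ys \<and> \<Phi> xs ys \<le> \<Phi> x ys)"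

(* h plays the role of the conjugate of g.  If f x = h y = \<infinity>, the value is \<infinity> - \<infinity> = \<infinity>
   in ereal.  This convention creates no spurious saddle points: for proper f and h,
   every saddle point (xs, ys) satisfies xs \<in> edom f and ys \<in> edom h. *)
definition lagrangian ::
  "(real^'n \<Rightarrow> ereal) \<Rightarrow> (real^'m \<Rightarrow> ereal) \<Rightarrow> real^'n^'m \<Rightarrow> real^'n \<Rightarrow> real^'m \<Rightarrow> ereal" where
  "lagrangian f h F x y = f x + ereal ((F *v x) \<bullet> y) - h y"

definition matrix_opnorm :: "real^'n^'m \<Rightarrow> real" where
  "matrix_opnorm F = onorm (\<lambda>x. F *v x)"

(* The argmin and argmax equations are read as "the new iterate is a minimizer (maximizer)
   over the whole space"; h plays the role of the conjugate of g. *)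
definition pdhg ::
  "(real^'n \<Rightarrow> ereal) \<Rightarrow> (real^'m \<Rightarrow> ereal) \<Rightarrow> real^'n^'m \<Rightarrow>
   (nat \<Rightarrow> real) \<Rightarrow> (nat \<Rightarrow> real) \<Rightarrow> (nat \<Rightarrow> real) \<Rightarrow>
   (nat \<Rightarrow> real^'n) \<Rightarrow> (nat \<Rightarrow> real^'m) \<Rightarrow> bool" where
  "pdhg f h F \<tau> \<sigma> \<theta> x y \<longleftrightarrow>
     (\<forall>k. \<tau> k > 0 \<and> \<sigma> k > 0 \<and> \<theta> k \<in> {0<..1}) \<and>
     (\<forall>k. is_arg_min
            (\<lambda>u. f u + ereal ((F *v u) \<bullet> y k) + ereal (1 / (2 * \<tau> k) * (norm (u - x k))\<^sup>2))
            (\<lambda>_. True) (x (Suc k)) \<and>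
          (let xbar = x (Suc k) + \<theta> k *\<^sub>R (x (Suc k) - x k)
           in is_arg_max
            (\<lambda>v. - h v + ereal ((F *v xbar) \<bullet> v) - ereal (1 / (2 * \<sigma> k) * (norm (v - y k))\<^sup>2))
            (\<lambda>_. True) (y (Suc k))))"

definition pdhg_energy ::
  "real^'n^'m \<Rightarrow> real \<Rightarrow> real \<Rightarrow> real^'n \<Rightarrow> real^'m \<Rightarrow>
   (nat \<Rightarrow> real^'n) \<Rightarrow> (nat \<Rightarrow> real^'m) \<Rightarrow> nat \<Rightarrow> real" where
  "pdhg_energy F \<tau> \<sigma> xs ys x y k =
     1 / (2 * \<tau>) * (norm (x k - xs))\<^sup>2 + 1 / (2 * \<sigma>) * (norm (y k - ys))\<^sup>2
       - (F *v (x k - xs)) \<bullet> (y k - ys)"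

end

theory Submission
  imports Defs
begin

text \<open>
  Fermat's rule turns the two proximal steps into subgradient inclusions at
  \<open>x (Suc k)\<close> and \<open>y (Suc k)\<close>; the saddle point gives inclusions at \<open>xs\<close> and \<open>ys\<close>.  Adding the
  two strong monotonicity inequalities, the cross terms combine so that with the quadratic form
  \<open>B a b = |a|\<^sup>2 / (2 \<tau>) + |b|\<^sup>2 / (2 \<sigma>) - (F a) \<bullet> b\<close> one has, for the errors \<open>a, b\<close> and the
  new errors \<open>a', b'\<close>,
  \<open>B a' b' + B (a' - a) (b' - b) + \<mu> |a'|\<^sup>2 + \<gamma> |b'|\<^sup>2 \<le> B a b\<close>.
  For the chosen step sizes \<open>B a b\<close> lies between \<open>1 - s |F|\<close> and \<open>1 + s |F|\<close> times
  \<open>(\<mu> |a|\<^sup>2 + \<gamma> |b|\<^sup>2) / (2 s sqrt (\<mu> \<gamma>))\<close>, so the middle term can be dropped and the last one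
  contracts the energy.
\<close>

section \<open>Subgradient inclusions obtained from minimality\<close>

lemma proper_fun_arg_min_finite:
  assumes f: "proper_fun f"
    and min: "\<And>z. f p + ereal (r p) \<le> f z + ereal (r z)"
  shows "\<bar>f p\<bar> \<noteq> \<infinity>"
proof -
  obtain z where "f z < \<infinity>"
    using f by (auto simp: proper_fun_def edom_def)
  then show ?thesis
    using min[of z] f by (cases "f p"; cases "f z") (auto simp: proper_fun_def)
qed

text \<open>Fermat's rule without a sum rule: \<open>p\<close> is compared with points on the
  segment towards \<open>z\<close>, and convexity isolates the first-order terms. The value
  \<open>c = 0\<close> serves the saddle point, \<open>c = 1 / (2 * \<tau> k)\<close> and
  \<open>c = 1 / (2 * \<sigma> k)\<close> the proximal steps.\<close>

lemma subgradient_of_arg_min_add_quadratic: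
  fixes f :: "'a::real_inner \<Rightarrow> ereal"
  assumes f: "proper_fun f" and conv: "convex_efun f"
    and min: "\<And>z. f p + ereal (a \<bullet> p + c * (norm (p - q))\<^sup>2)
                  \<le> f z + ereal (a \<bullet> z + c * (norm (z - q))\<^sup>2)"
  shows "- a - (2 * c) *\<^sub>R (p - q) \<in> subdifferential f p"
proof -
  have "\<bar>f p\<bar> \<noteq> \<infinity>"
    by (rule proper_fun_arg_min_finite[OF f min])
  then obtain P where P: "f p = ereal P" by (cases "f p") auto
  have "f z \<ge> f p + ereal ((- a - (2 * c) *\<^sub>R (p - q)) \<bullet> (z - p))" for z
  proof (cases "f z")
    case (real Z)
    \<comment> \<open>\<open>D\<close> is the defect of the subgradient inequality at
      \<open>z\<close>; the goal is \<open>D \<le> 0\<close>.\<close>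
    define D where "D = P - Z - (a + (2 * c) *\<^sub>R (p - q)) \<bullet> (z - p)"
    have line: "D \<le> t * (c * (norm (z - p))\<^sup>2)" if t: "0 < t" "t \<le> 1" for t
    proof -
      define u where "u = (1 - t) *\<^sub>R p + t *\<^sub>R z"
      have u: "u - q = (p - q) + t *\<^sub>R (z - p)" "u = p + t *\<^sub>R (z - p)"
        by (simp_all add: u_def algebra_simps)
      have "f u \<le> ereal (1 - t) * f p + ereal t * f z"
        using conv t unfolding convex_efun_def u_def by auto
      then have "f u \<le> ereal ((1 - t) * P + t * Z)"
        using P real by simp
      then have "P + (a \<bullet> p + c * (norm (p - q))\<^sup>2)
          \<le> (1 - t) * P + t * Z + (a \<bullet> u + c * (norm (u - q))\<^sup>2)"
        using min[of u] P by (cases "f u") auto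
      moreover have "(norm (u - q))\<^sup>2
          = (norm (p - q))\<^sup>2 + 2 * t * ((p - q) \<bullet> (z - p)) + t\<^sup>2 * (norm (z - p))\<^sup>2"
        unfolding u(1) power2_norm_eq_inner
        by (simp add: inner_add_left inner_add_right power2_eq_square inner_commute)
      moreover have "a \<bullet> u = a \<bullet> p + t * (a \<bullet> (z - p))"
        by (simp add: u(2) inner_add_right)
      moreover have "t * D = P - ((1 - t) * P + t * Z) - t * (a \<bullet> (z - p))
          - c * (2 * t * ((p - q) \<bullet> (z - p)))"
        by (simp add: D_def inner_add_left algebra_simps)
      \<comment> \<open>All first-order terms are collected in \<open>t * D\<close>. After division
        by \<open>t\<close> the remainder still vanishes as \<open>t\<close> tends to 0.\<close>
      ultimately have "t * D \<le> t * (t * (c * (norm (z - p))\<^sup>2))"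
        by (simp add: power2_eq_square distrib_left mult_ac)
      then show ?thesis using t by simp
    qed
    have "((\<lambda>t. t * (c * (norm (z - p))\<^sup>2)) \<longlongrightarrow> 0 * (c * (norm (z - p))\<^sup>2)) (at_right 0)"
      by (intro tendsto_intros)
    moreover have "\<forall>\<^sub>F t in at_right 0. D \<le> t * (c * (norm (z - p))\<^sup>2)"
      using line by (auto simp: eventually_at_right[of 0 1] intro!: exI[of _ 1])
    ultimately have "D \<le> 0 * (c * (norm (z - p))\<^sup>2)"
      by (rule tendsto_lowerbound) simp
    then show ?thesis
      using P real by (simp add: D_def inner_diff_left inner_add_left)
  next
    case MInf
    then show ?thesis using f by (simp add: proper_fun_def)
  qed simp
  then show ?thesis using P by (simp add: subdifferential_def edom_def)
qed

text \<open>Strong convexity is used from \<open>p\<close> to \<open>q\<close> and from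
  \<open>q\<close> to \<open>p\<close>. In the sum the function values cancel, being finite where
  subgradients exist, and the two halves of \<mu> add up.\<close>

lemma subdifferential_strongly_monotone:
  assumes f: "f \<in> strongly_convex_funs \<mu>"
    and v: "v \<in> subdifferential f p" and w: "w \<in> subdifferential f q"
  shows "\<mu> * (norm (p - q))\<^sup>2 \<le> (v - w) \<bullet> (p - q)"
proof -
  have proper: "f z \<noteq> -\<infinity>" for z
    using f by (auto simp: strongly_convex_funs_def closed_convex_funs_def proper_fun_def)
  have "f p < \<infinity>" "f q < \<infinity>"
    using v w by (auto simp: subdifferential_def edom_def)
  with proper obtain P Q where PQ: "f p = ereal P" "f q = ereal Q"
    by (metis ereal_cases ereal_infty_less(1))
  have "f q \<ge> f p + ereal (v \<bullet> (q - p)) + ereal (\<mu> / 2 * (norm (q - p))\<^sup>2)"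
    and "f p \<ge> f q + ereal (w \<bullet> (p - q)) + ereal (\<mu> / 2 * (norm (p - q))\<^sup>2)"
    using f v w by (auto simp: strongly_convex_funs_def)
  then show ?thesis
    using PQ by (simp add: norm_minus_commute inner_diff_left inner_diff_right algebra_simps)
qed

text \<open>Once \<open>f xs\<close> and \<open>h ys\<close> are known to be finite they can be
  cancelled, so \<open>xs\<close> and \<open>ys\<close> each minimize a convex function plus a
  linear one.\<close>

lemma saddle_point_lagrangian_subgradients:
  fixes f :: "real^'n \<Rightarrow> ereal" and h :: "real^'m \<Rightarrow> ereal"
  assumes f: "proper_fun f" "convex_efun f" and h: "proper_fun h" "convex_efun h"
    and saddle: "saddle_point (lagrangian f h F) xs ys"
  shows "- (ys v* F) \<in> subdifferential f xs" and "F *v xs \<in> subdifferential h ys"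
proof -
  obtain x0 y0 where fin: "f x0 < \<infinity>" "h y0 < \<infinity>"
    using f h by (auto simp: proper_fun_def edom_def)
  have pf: "f u \<noteq> -\<infinity>" and ph: "h v \<noteq> -\<infinity>" for u v
    using f h by (auto simp: proper_fun_def)
  have max: "f xs + ereal ((F *v xs) \<bullet> v) - h v \<le> f xs + ereal ((F *v xs) \<bullet> ys) - h ys"
    and min: "f xs + ereal ((F *v xs) \<bullet> ys) - h ys \<le> f u + ereal ((F *v u) \<bullet> ys) - h ys" for u v
    using saddle by (auto simp: saddle_point_def lagrangian_def)
  \<comment> \<open>As \<infinity> - \<infinity> = \<infinity> in \<open>ereal\<close>,
    \<open>f xs = \<infinity>\<close> would make the left side of \<open>min\<close> infinite
    whatever \<open>h ys\<close> is, while the right side at \<open>x0\<close> is not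
    \<infinity>.\<close>
  obtain X where X: "f xs = ereal X"
    using min[of x0] fin pf[of xs] pf[of x0] ph[of ys]
    by (cases "f xs"; cases "f x0"; cases "h ys") auto
  obtain Y where Y: "h ys = ereal Y"
    using max[of y0] fin ph[of ys] ph[of y0] X by (cases "h ys"; cases "h y0") auto
  \<comment> \<open>With \<open>c = 0\<close> the quadratic vanishes, so the centre 0 is an
    arbitrary choice.\<close>
  have "- (ys v* F) - (2 * 0) *\<^sub>R (xs - 0) \<in> subdifferential f xs"
  proof (rule subgradient_of_arg_min_add_quadratic[OF f])
    show "f xs + ereal ((ys v* F) \<bullet> xs + 0 * (norm (xs - 0))\<^sup>2)
        \<le> f z + ereal ((ys v* F) \<bullet> z + 0 * (norm (z - 0))\<^sup>2)" for z
      using min[of z] pf[of z] X Y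
      by (cases "f z") (auto simp: dot_lmul_matrix inner_commute[of ys])
  qed
  then show "- (ys v* F) \<in> subdifferential f xs" by simp
  have "- (- (F *v xs)) - (2 * 0) *\<^sub>R (ys - 0) \<in> subdifferential h ys"
  proof (rule subgradient_of_arg_min_add_quadratic[OF h])
    show "h ys + ereal (- (F *v xs) \<bullet> ys + 0 * (norm (ys - 0))\<^sup>2)
        \<le> h z + ereal (- (F *v xs) \<bullet> z + 0 * (norm (z - 0))\<^sup>2)" for z
      using max[of z] ph[of z] X Y by (cases "h z") auto
  qed
  then show "F *v xs \<in> subdifferential h ys" by simp
qed

lemma pdhg_subgradients:
  fixes f :: "real^'n \<Rightarrow> ereal" and h :: "real^'m \<Rightarrow> ereal"
  assumes f: "proper_fun f" "convex_efun f" and h: "proper_fun h" "convex_efun h"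
    and pdhg: "pdhg f h F \<tau> \<sigma> \<theta> x y"
  shows "- (y k v* F) - (1 / \<tau> k) *\<^sub>R (x (Suc k) - x k) \<in> subdifferential f (x (Suc k))"
    and "F *v (x (Suc k) + \<theta> k *\<^sub>R (x (Suc k) - x k)) - (1 / \<sigma> k) *\<^sub>R (y (Suc k) - y k)
           \<in> subdifferential h (y (Suc k))"
proof -
  define w where "w = F *v (x (Suc k) + \<theta> k *\<^sub>R (x (Suc k) - x k))"
  have min: "f (x (Suc k)) + ereal ((F *v x (Suc k)) \<bullet> y k)
        + ereal (1 / (2 * \<tau> k) * (norm (x (Suc k) - x k))\<^sup>2)
      \<le> f u + ereal ((F *v u) \<bullet> y k) + ereal (1 / (2 * \<tau> k) * (norm (u - x k))\<^sup>2)" for u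
    using pdhg by (auto simp: pdhg_def is_arg_min_linorder)
  have max: "- h v + ereal (w \<bullet> v) - ereal (1 / (2 * \<sigma> k) * (norm (v - y k))\<^sup>2)
      \<le> - h (y (Suc k)) + ereal (w \<bullet> y (Suc k))
        - ereal (1 / (2 * \<sigma> k) * (norm (y (Suc k) - y k))\<^sup>2)" for v
    using pdhg unfolding pdhg_def Let_def w_def by (auto simp: is_arg_max_linorder)
  have "- (y k v* F) - (2 * (1 / (2 * \<tau> k))) *\<^sub>R (x (Suc k) - x k) \<in> subdifferential f (x (Suc k))"
  proof (rule subgradient_of_arg_min_add_quadratic[OF f])
    show "f (x (Suc k)) + ereal ((y k v* F) \<bullet> x (Suc k)
          + 1 / (2 * \<tau> k) * (norm (x (Suc k) - x k))\<^sup>2)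
        \<le> f z + ereal ((y k v* F) \<bullet> z + 1 / (2 * \<tau> k) * (norm (z - x k))\<^sup>2)" for z
      using min[of z] by (simp add: dot_lmul_matrix inner_commute[of "y k"] add.assoc)
  qed
  then show "- (y k v* F) - (1 / \<tau> k) *\<^sub>R (x (Suc k) - x k) \<in> subdifferential f (x (Suc k))"
    by simp
  \<comment> \<open>Negating the objective turns the maximization into a minimization with linear
    term \<open>- w\<close>.\<close>
  have "- (- w) - (2 * (1 / (2 * \<sigma> k))) *\<^sub>R (y (Suc k) - y k) \<in> subdifferential h (y (Suc k))"
  proof (rule subgradient_of_arg_min_add_quadratic[OF h])
    show "h (y (Suc k)) + ereal (- w \<bullet> y (Suc k)
          + 1 / (2 * \<sigma> k) * (norm (y (Suc k) - y k))\<^sup>2)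
        \<le> h z + ereal (- w \<bullet> z + 1 / (2 * \<sigma> k) * (norm (z - y k))\<^sup>2)" for z
      using max[of z] h(1)
      by (cases "h (y (Suc k))"; cases "h z") (auto simp: proper_fun_def)
  qed
  then show "F *v (x (Suc k) + \<theta> k *\<^sub>R (x (Suc k) - x k)) - (1 / \<sigma> k) *\<^sub>R (y (Suc k) - y k)
           \<in> subdifferential h (y (Suc k))"
    by (simp add: w_def)
qed

section \<open>The quadratic form behind the energy, and its decrease in one step\<close>

lemma abs_matrix_inner_le:
  fixes F :: "real^'n^'m"
  shows "\<bar>(F *v a) \<bullet> b\<bar> \<le> matrix_opnorm F * norm a * norm b"
proof -
  have "\<bar>(F *v a) \<bullet> b\<bar> \<le> norm (F *v a) * norm b"
    by (rule Cauchy_Schwarz_ineq2)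
  also have "\<dots> \<le> matrix_opnorm F * norm a * norm b"
    unfolding matrix_opnorm_def
    by (intro mult_right_mono onorm matrix_vector_mul_bounded_linear) simp
  finally show ?thesis .
qed

text \<open>The energy with free error arguments, since it is also needed at the increments between
  consecutive iterates.\<close>

definition pdhg_form :: "real^'n^'m \<Rightarrow> real \<Rightarrow> real \<Rightarrow> real^'n \<Rightarrow> real^'m \<Rightarrow> real" where
  "pdhg_form F \<tau> \<sigma> a b =
     1 / (2 * \<tau>) * (norm a)\<^sup>2 + 1 / (2 * \<sigma>) * (norm b)\<^sup>2 - (F *v a) \<bullet> b"

text \<open>The step sizes satisfy \<mu>\<tau> = \<gamma>\<sigma> =
  \<open>s * sqrt (\<mu> * \<gamma>)\<close>, so scaling makes the diagonal part exactly \<mu>|a|^2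
  + \<gamma>|b|^2; the cross term costs at most a fraction s|F| of it.\<close>

lemma pdhg_form_bounds:
  fixes F :: "real^'n^'m"
  assumes pos: "\<mu> > 0" "\<gamma> > 0" "s > 0"
    and \<tau>: "\<tau> = s * sqrt (\<gamma> / \<mu>)" and \<sigma>: "\<sigma> = s * sqrt (\<mu> / \<gamma>)"
  shows "(1 - s * matrix_opnorm F) * (\<mu> * (norm a)\<^sup>2 + \<gamma> * (norm b)\<^sup>2)
           \<le> 2 * s * sqrt (\<mu> * \<gamma>) * pdhg_form F \<tau> \<sigma> a b" (is ?lower)
    and "2 * s * sqrt (\<mu> * \<gamma>) * pdhg_form F \<tau> \<sigma> a b
           \<le> (1 + s * matrix_opnorm F) * (\<mu> * (norm a)\<^sup>2 + \<gamma> * (norm b)\<^sup>2)" (is ?upper)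
proof -
  define N where "N = matrix_opnorm F"
  define Q where "Q = \<mu> * (norm a)\<^sup>2 + \<gamma> * (norm b)\<^sup>2"
  define S where "S = sqrt (\<mu> * \<gamma>)"
  have S: "S > 0" using pos by (simp add: S_def)
  have N: "N \<ge> 0"
    by (simp add: N_def matrix_opnorm_def onorm_pos_le matrix_vector_mul_bounded_linear)
  have steps: "S / \<tau> = \<mu> / s" "S / \<sigma> = \<gamma> / s"
    using pos by (simp_all add: S_def \<tau> \<sigma> real_sqrt_mult real_sqrt_divide field_simps)
  have "2 * s * S * pdhg_form F \<tau> \<sigma> a b
      = s * (S / \<tau>) * (norm a)\<^sup>2 + s * (S / \<sigma>) * (norm b)\<^sup>2 - 2 * s * S * ((F *v a) \<bullet> b)"
    by (simp add: pdhg_form_def field_simps)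
  also have "\<dots> = Q - 2 * s * S * ((F *v a) \<bullet> b)"
    using pos by (simp add: steps Q_def)
  finally have form: "2 * s * S * pdhg_form F \<tau> \<sigma> a b = Q - 2 * s * S * ((F *v a) \<bullet> b)" .
  \<comment> \<open>These weights give the mixed term of the square the factor \<open>2 * S\<close>
    of the scaled cross term.\<close>
  have "0 \<le> (sqrt \<mu> * norm a - sqrt \<gamma> * norm b)\<^sup>2" by simp
  also have "\<dots> = Q - 2 * S * (norm a * norm b)"
    using pos by (simp add: Q_def S_def power2_diff power_mult_distrib real_sqrt_mult)
  finally have amgm: "2 * S * (norm a * norm b) \<le> Q" by simp
  have "\<bar>2 * s * S * ((F *v a) \<bullet> b)\<bar> = 2 * s * S * \<bar>(F *v a) \<bullet> b\<bar>"
    using pos S by (simp add: abs_mult)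
  also have "\<dots> \<le> 2 * s * S * (N * norm a * norm b)"
    using pos S abs_matrix_inner_le[of F a b] by (intro mult_left_mono) (auto simp: N_def)
  also have "\<dots> = s * N * (2 * S * (norm a * norm b))" by simp
  also have "\<dots> \<le> s * N * Q"
    using pos N amgm by (intro mult_left_mono) auto
  finally have cross: "\<bar>2 * s * S * ((F *v a) \<bullet> b)\<bar> \<le> s * N * Q" .
  show ?lower ?upper
    using cross form unfolding N_def Q_def S_def by (auto simp: abs_le_iff algebra_simps)
qed

text \<open>The extrapolated point \<open>a' + (a' - a)\<close> makes the coupling terms close up:
  2(Fa').b' - (Fa').b - (Fa).b' = (Fa').b' + (F(a' - a)).(b' - b) - (Fa).b. Polarization does the
  same for the proximal terms.\<close>

lemma pdhg_form_step:
  fixes F :: "real^'n^'m"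
  assumes x: "\<mu> * (norm a')\<^sup>2 \<le> (- (b v* F) - (1 / \<tau>) *\<^sub>R (a' - a)) \<bullet> a'"
    and y: "\<gamma> * (norm b')\<^sup>2 \<le> (F *v (a' + (a' - a)) - (1 / \<sigma>) *\<^sub>R (b' - b)) \<bullet> b'"
  shows "pdhg_form F \<tau> \<sigma> a' b' + pdhg_form F \<tau> \<sigma> (a' - a) (b' - b)
           + (\<mu> * (norm a')\<^sup>2 + \<gamma> * (norm b')\<^sup>2) \<le> pdhg_form F \<tau> \<sigma> a b"
proof -
  have polar: "(u' - u) \<bullet> u' = ((norm u')\<^sup>2 + (norm (u' - u))\<^sup>2 - (norm u)\<^sup>2) / 2"
    for u u' :: "'b::real_inner"
    by (simp add: power2_norm_eq_inner inner_diff_left inner_diff_right inner_commute)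
  have x': "\<mu> * (norm a')\<^sup>2 \<le> - ((F *v a') \<bullet> b) - (1 / \<tau>) * ((a' - a) \<bullet> a')"
    using x by (simp add: inner_diff_left dot_lmul_matrix inner_commute[of b])
  have y': "\<gamma> * (norm b')\<^sup>2
      \<le> 2 * ((F *v a') \<bullet> b') - (F *v a) \<bullet> b' - (1 / \<sigma>) * ((b' - b) \<bullet> b')"
    using y unfolding matrix_vector_right_distrib matrix_vector_mult_diff_distrib
      inner_diff_left inner_add_left inner_scaleR_left by linarith
  show ?thesis
    using x' y' unfolding polar pdhg_form_def
    by (simp add: inner_diff_left inner_diff_right matrix_vector_mult_diff_distrib
        algebra_simps add_divide_distrib diff_divide_distrib)
qed

text \<open>In \<open>ereal\<close> the bound is \<infinity> for \<open>N = 0\<close>, where the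
  claim is trivial; otherwise it is the claim squared.\<close>

lemma mult_less_one_of_ereal_square:
  fixes s N :: real
  assumes "s > 0" "N \<ge> 0" "ereal (s\<^sup>2) < 1 / (ereal N)\<^sup>2"
  shows "s * N < 1"
proof (cases "N = 0")
  case False
  then have "1 / (ereal N)\<^sup>2 = ereal (1 / N\<^sup>2)"
    by (simp add: power2_eq_square one_ereal_def)
  then have "(s * N)\<^sup>2 < 1\<^sup>2"
    using assms False by (simp add: power_mult_distrib field_simps)
  then show ?thesis by (rule power2_less_imp_less) simp
qed simp

section \<open>Contraction of the energy and convergence of the iterates\<close>

theorem theorem5p2:
  fixes f :: "real^'d1 \<Rightarrow> ereal" and g :: "real^'d2 \<Rightarrow> ereal"
    and F :: "real^'d1^'d2"
    and \<mu> \<gamma> s \<tau> \<sigma> :: real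
    and xs :: "real^'d1" and ys :: "real^'d2"
    and x :: "nat \<Rightarrow> real^'d1" and y :: "nat \<Rightarrow> real^'d2"
  assumes "\<mu> > 0" and "\<gamma> > 0"
    and "f \<in> strongly_convex_funs \<mu>"
    and "conjugate_fun g \<in> strongly_convex_funs \<gamma>"
    and "s > 0"
    and "ereal (s\<^sup>2) \<in> {0<..<1 / (ereal (matrix_opnorm F))\<^sup>2}"
    and "saddle_point (lagrangian f (conjugate_fun g) F) xs ys"
    and "\<tau> = s * sqrt (\<gamma> / \<mu>)" and "\<sigma> = s * sqrt (\<mu> / \<gamma>)"
    and "pdhg f (conjugate_fun g) F (\<lambda>_. \<tau>) (\<lambda>_. \<sigma>) (\<lambda>_. 1) x y"
  shows "(\<forall>k. pdhg_energy F \<tau> \<sigma> xs ys x y k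
           \<le> ((1 + s * matrix_opnorm F) / (1 + s * matrix_opnorm F + 2 * s * sqrt (\<mu> * \<gamma>))) ^ k
              * pdhg_energy F \<tau> \<sigma> xs ys x y 0)
    \<and> (\<lambda>k. (x k, y k)) \<longlonglongrightarrow> (xs, ys)
    \<and> (\<forall>k. \<mu> * (norm (x k - xs))\<^sup>2 + \<gamma> * (norm (y k - ys))\<^sup>2
           \<le> (1 + s * matrix_opnorm F) / (1 - s * matrix_opnorm F)
              * ((1 + s * matrix_opnorm F) / (1 + s * matrix_opnorm F + 2 * s * sqrt (\<mu> * \<gamma>))) ^ k
              * (\<mu> * (norm (x 0 - xs))\<^sup>2 + \<gamma> * (norm (y 0 - ys))\<^sup>2))"
proof -
  define h where "h = conjugate_fun g"
  define N where "N = matrix_opnorm F"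
  define c where "c = 2 * s * sqrt (\<mu> * \<gamma>)"
  define q where "q = (1 + s * N) / (1 + s * N + c)"
  define E where "E k = pdhg_energy F \<tau> \<sigma> xs ys x y k" for k
  define Q where "Q k = \<mu> * (norm (x k - xs))\<^sup>2 + \<gamma> * (norm (y k - ys))\<^sup>2" for k
  note pos = \<open>\<mu> > 0\<close> \<open>\<gamma> > 0\<close> \<open>s > 0\<close>
  note bounds = pdhg_form_bounds[OF pos \<open>\<tau> = _\<close> \<open>\<sigma> = _\<close>, of F, folded N_def c_def]
  have c: "c > 0" using pos by (simp add: c_def)
  have N: "N \<ge> 0"
    by (simp add: N_def matrix_opnorm_def onorm_pos_le matrix_vector_mul_bounded_linear)
  then have sN: "s * N < 1"
    using mult_less_one_of_ereal_square[OF \<open>s > 0\<close>, of N] assms(6) by (simp add: N_def)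
  have q: "0 \<le> q" "q < 1" using c N pos by (auto simp: q_def add_nonneg_pos divide_less_eq_1)
  have f: "proper_fun f" "convex_efun f" and h: "proper_fun h" "convex_efun h"
    using assms(3,4) by (auto simp: strongly_convex_funs_def closed_convex_funs_def h_def)
  \<comment> \<open>Facts 1 and 2 hold at the saddle point, 3 and 4 at the new iterates.\<close>
  note inclusions =
    saddle_point_lagrangian_subgradients[OF f h assms(7)[folded h_def]]
    pdhg_subgradients[OF f h assms(10)[folded h_def]]
  have E_form: "E k = pdhg_form F \<tau> \<sigma> (x k - xs) (y k - ys)" for k
    by (simp add: E_def pdhg_energy_def pdhg_form_def)
  have lower: "(1 - s * N) * Q k \<le> c * E k" and upper: "c * E k \<le> (1 + s * N) * Q k" for k
    unfolding E_form Q_def by (rule bounds)+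
  have step: "E (Suc k) + Q (Suc k) \<le> E k" for k
  proof -
    have "\<mu> * (norm (x (Suc k) - xs))\<^sup>2
        \<le> (- (y k v* F) - (1 / \<tau>) *\<^sub>R (x (Suc k) - x k) - - (ys v* F)) \<bullet> (x (Suc k) - xs)"
      by (rule subdifferential_strongly_monotone[OF assms(3) inclusions(3,1)])
    \<comment> \<open>Only differences from the saddle point remain, as
      \<open>pdhg_form_step\<close> requires.\<close>
    also have "\<dots> = (- ((y k - ys) v* F) - (1 / \<tau>) *\<^sub>R ((x (Suc k) - xs) - (x k - xs)))
        \<bullet> (x (Suc k) - xs)"
      by (simp add: vector_matrix_mult_diff_distrib algebra_simps inner_diff_left)
    finally have x_ineq: "\<mu> * (norm (x (Suc k) - xs))\<^sup>2 \<le> \<dots>" .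
    have "\<gamma> * (norm (y (Suc k) - ys))\<^sup>2
        \<le> (F *v (x (Suc k) + 1 *\<^sub>R (x (Suc k) - x k)) - (1 / \<sigma>) *\<^sub>R (y (Suc k) - y k) - F *v xs)
          \<bullet> (y (Suc k) - ys)"
      by (rule subdifferential_strongly_monotone[OF assms(4)[folded h_def] inclusions(4,2)])
    also have "\<dots> = (F *v ((x (Suc k) - xs) + ((x (Suc k) - xs) - (x k - xs)))
        - (1 / \<sigma>) *\<^sub>R ((y (Suc k) - ys) - (y k - ys))) \<bullet> (y (Suc k) - ys)"
      unfolding matrix_vector_right_distrib matrix_vector_mult_diff_distrib scaleR_one
      by (simp add: inner_diff_left inner_add_left)
    finally have y_ineq: "\<gamma> * (norm (y (Suc k) - ys))\<^sup>2 \<le> \<dots>" .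
    let ?D = "pdhg_form F \<tau> \<sigma> ((x (Suc k) - xs) - (x k - xs)) ((y (Suc k) - ys) - (y k - ys))"
    \<comment> \<open>Since \<open>s * N < 1\<close>, the lower bound makes the form nonnegative at
      the increments.\<close>
    have "0 \<le> c * ?D"
      using pos sN by (intro order_trans[OF _ bounds(1)] mult_nonneg_nonneg) auto
    then have "0 \<le> ?D" using c by (simp add: zero_le_mult_iff)
    then show ?thesis
      using pdhg_form_step[OF x_ineq y_ineq] by (simp add: E_form Q_def)
  qed
  have contract: "E (Suc k) \<le> q * E k" for k
  proof -
    \<comment> \<open>The upper bound trades \<open>c * E (Suc k)\<close> for
      \<open>Q (Suc k)\<close>, which \<open>step\<close> absorbs; this produces the denominator of
      \<open>q\<close>.\<close>
    have "(1 + s * N + c) * E (Suc k) \<le> (1 + s * N) * (E (Suc k) + Q (Suc k))"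
      using upper[of "Suc k"] by (simp add: algebra_simps)
    also have "\<dots> \<le> (1 + s * N) * E k"
      using step pos N by (intro mult_left_mono) auto
    finally show ?thesis
      using pos N c by (simp add: q_def field_simps add_pos_nonneg)
  qed
  have energy: "E k \<le> q ^ k * E 0" for k
  proof (induction k)
    case (Suc k)
    have "E (Suc k) \<le> q * (q ^ k * E 0)"
      using contract[of k] mult_left_mono[OF Suc q(1)] by linarith
    then show ?case by simp
  qed simp
  have rate: "Q k \<le> (1 + s * N) / (1 - s * N) * q ^ k * Q 0" for k
  proof -
    \<comment> \<open>Passing from \<open>Q\<close> to \<open>E\<close> and back by the two form
      bounds costs the factor (1 + sN) / (1 - sN).\<close>
    have "(1 - s * N) * Q k \<le> c * (q ^ k * E 0)"
      using lower[of k] mult_left_mono[OF energy[of k], of c] c by linarith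
    also have "\<dots> = q ^ k * (c * E 0)" by simp
    also have "\<dots> \<le> q ^ k * ((1 + s * N) * Q 0)"
      using q upper by (intro mult_left_mono) auto
    finally show ?thesis using sN by (simp add: field_simps)
  qed
  have "(\<lambda>k. (1 + s * N) / (1 - s * N) * q ^ k * Q 0) \<longlonglongrightarrow> (1 + s * N) / (1 - s * N) * 0 * Q 0"
    using q by (intro tendsto_intros LIMSEQ_power_zero) auto
  then have Q_lim: "(\<lambda>k. (1 + s * N) / (1 - s * N) * q ^ k * Q 0) \<longlonglongrightarrow> 0"
    by simp
  \<comment> \<open>Stated for any normed space, so that it applies to both \<open>x\<close> and
    \<open>y\<close>; the weighted squared distance is squeezed by the geometric bound on
    \<open>Q\<close>.\<close>
  have lim: "u \<longlonglongrightarrow> l" if "m > 0" and "\<And>k. m * (norm (u k - l))\<^sup>2 \<le> Q k"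
    for u :: "nat \<Rightarrow> 'b::real_normed_vector" and l m
  proof -
    have "(\<lambda>k. m * (norm (u k - l))\<^sup>2) \<longlonglongrightarrow> 0"
      by (rule tendsto_sandwich[OF _ _ tendsto_const Q_lim])
        (use that order_trans[OF that(2) rate] in auto)
    from tendsto_divide[OF this tendsto_const, of m] have "(\<lambda>k. (norm (u k - l))\<^sup>2) \<longlonglongrightarrow> 0"
      using \<open>m > 0\<close> by simp
    then have "(\<lambda>k. norm (u k - l)) \<longlonglongrightarrow> 0"
      using tendsto_real_sqrt by fastforce
    then show ?thesis by (simp add: LIM_zero_iff tendsto_norm_zero_iff)
  qed
  have "x \<longlonglongrightarrow> xs"
    using pos by (intro lim[of \<mu>]) (auto simp: Q_def)
  moreover have "y \<longlonglongrightarrow> ys"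
    using pos by (intro lim[of \<gamma>]) (auto simp: Q_def)
  ultimately have "(\<lambda>k. (x k, y k)) \<longlonglongrightarrow> (xs, ys)" by (rule tendsto_Pair)
  then show ?thesis
    using energy rate unfolding E_def Q_def q_def c_def N_def by blast
qed

end
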